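(* Let $\mathcal{A} \subset \mathbb{C}$ be the attractor of the iterated function system $\{S^{-1}, T^{-1}\}$, where $$S^{-1}(z) = \frac{z}{1+i}, \qquad T^{-1}(z) = \frac{z-(2+i)}{1+i}.$$ Then $$\mathcal{A} = \left\{ -\frac{2+i}{1+i}\sum_{k=0}^{\infty}\varepsilon_k (1+i)^{-k} : \varepsilon_k \in \{0,1\} \right\} = (-2-i)\,\mathcal{T},$$ where $\mathcal{T} = \left\{ \sum_{k=1}^{\infty} \delta_k (1+i)^{-k} : \delta_k \in \{0,1\} \right\}$ is the Twindragon. Hence $\mathcal{A}$ is the image of the Twindragon $\mathcal{T}$ under the similarity $z \mapsto (-2-i)z$, and in particular is similar to it.
   Context: The attractor of a pair of contractions $\{g_1,g_2\}$ of $\mathbb{C}$ is the unique nonempty compact set $K\subset\mathbb{C}$ with $K = g_1(K)\cup g_2(K)$. The maps $S^{-1}$ and $T^{-1}$ are the inverses of $S(z) = (1+i)z$ and $T(z) = (1+i)z + (2+i)$. The set $\mathcal{T}$, the base-$(1+i)$, digit-$\{0,1\}$ number-system tile, is what is meant by the Twindragon here. For a set $X\subset\mathbb{C}$ and $c\in\mathbb{C}$, $cX = \{cx : x\in X\}$. *)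

theory Defs
  imports "HOL-Analysis.Analysis"
begin

definition map_S :: "complex \<Rightarrow> complex" where
  "map_S z = (1 + \<i>) * z"

definition map_T :: "complex \<Rightarrow> complex" where
  "map_T z = (1 + \<i>) * z + (2 + \<i>)"

(* Only meaningful when such a K exists and is unique, e.g. for two contractions;
   otherwise the description operator returns an unspecified set. *)
definition attractor :: "(complex \<Rightarrow> complex) \<Rightarrow> (complex \<Rightarrow> complex) \<Rightarrow> complex set" where
  "attractor g1 g2 = (THE K. K \<noteq> {} \<and> compact K \<and> K = g1 ` K \<union> g2 ` K)"

(* The series starts at index 1: its j-th summand (j = 0, 1, ...) belongs to k = Suc j,
   and the value of \<delta> at 0 is irrelevant. *)
definition twindragon :: "complex set" where
  "twindragon =
     {\<Sum>j. of_nat (\<delta> (Suc j)) * (1 + \<i>) powi (- int (Suc j)) | \<delta> :: nat \<Rightarrow> nat.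
        \<forall>k. \<delta> k \<in> {0, 1}}"

definition similarity :: "(complex \<Rightarrow> complex) \<Rightarrow> bool" where
  "similarity f \<longleftrightarrow> bij f \<and> (\<exists>r>0. \<forall>x y. dist (f x) (f y) = r * dist x y)"

definition similar_sets :: "complex set \<Rightarrow> complex set \<Rightarrow> bool" where
  "similar_sets X Y \<longleftrightarrow> (\<exists>f. similarity f \<and> Y = f ` X)"

end

theory Submission
  imports Defs
begin

text \<open>
  Put \<open>w = 1 / (1 + \<i>)\<close> and \<open>d = - (2 + \<i>) w\<close>. The two maps are \<open>z \<mapsto> w z\<close> and
  \<open>z \<mapsto> w z + d\<close>, so they have the same linear part, of norm \<open>1 / sqrt 2 < 1\<close>. Applying them
  repeatedly writes a point of an invariant compact set \<open>K\<close> as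
  \<open>d (\<epsilon>\<^sub>0 + \<epsilon>\<^sub>1 w + \<dots> + \<epsilon>\<^sub>n\<^sub>-\<^sub>1 w^(n-1)) + w^n x\<^sub>n\<close> with binary digits and \<open>x\<^sub>n \<in> K\<close>;
  boundedness of \<open>K\<close> makes the remainder vanish, and closedness of \<open>K\<close> gives the converse, that
  every digit series is attained. Hence \<open>K\<close> can only be \<open>d\<close> times the set of all digit
  series (\<open>invariant_compact_eq\<close>), which settles uniqueness without a Hausdorff-metric fixed point
  argument.

  Existence is the observation that the digit series do form such a set. They are self-similar
  because splitting off the leading digit is one application of a map
  (\<open>digit_sums_self_similar\<close>), and compact because they are the image of the compact space
  \<open>{0,1}\<^sup>\<nat>\<close> under a uniform limit of continuous functions (\<open>compact_digit_sums\<close>).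

  The Twindragon starts its series at index 1, so it is \<open>w\<close> times the set of digit series. As
  \<open>d = (- 2 - \<i>) w\<close>, the attractor is \<open>- 2 - \<i>\<close> times the Twindragon.
\<close>

section \<open>Digit series\<close>

definition digit_sequences :: "(nat \<Rightarrow> nat) set" where
  "digit_sequences = {\<epsilon>. \<forall>k. \<epsilon> k \<in> {0, 1}}"

definition digit_series :: "complex \<Rightarrow> (nat \<Rightarrow> nat) \<Rightarrow> complex" where
  "digit_series w \<epsilon> = (\<Sum>k. of_nat (\<epsilon> k) * w ^ k)"

definition digit_sums :: "complex \<Rightarrow> complex set" where
  "digit_sums w = digit_series w ` digit_sequences"

lemma norm_digit_term_le:
  assumes "\<epsilon> \<in> digit_sequences"
  shows "norm (of_nat (\<epsilon> k) * w ^ k :: complex) \<le> norm w ^ k"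
proof -
  have "\<epsilon> k = 0 \<or> \<epsilon> k = 1"
    using assms by (auto simp: digit_sequences_def)
  then show ?thesis
    by (auto simp: norm_mult norm_power)
qed

lemma summable_digit_series:
  assumes "norm w < 1" "\<epsilon> \<in> digit_sequences"
  shows "summable (\<lambda>k. of_nat (\<epsilon> k) * w ^ k :: complex)"
proof (rule summable_comparison_test)
  show "\<exists>N. \<forall>k\<ge>N. norm (of_nat (\<epsilon> k) * w ^ k) \<le> norm w ^ k"
    using norm_digit_term_le[OF assms(2)] by blast
  show "summable (\<lambda>k. norm w ^ k)"
    using assms(1) by (intro summable_geometric) simp
qed

text \<open>
  Removing the leading digit turns the series into a contracted copy of the shifted series; this is
  what ties digit sequences to the two maps of the iterated function system.
\<close>

lemma digit_series_unfold:
  assumes "norm w < 1" "\<epsilon> \<in> digit_sequences"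
  shows "digit_series w \<epsilon> = w * digit_series w (\<lambda>k. \<epsilon> (Suc k)) + of_nat (\<epsilon> 0)"
proof -
  have shift: "(\<lambda>k. \<epsilon> (Suc k)) \<in> digit_sequences"
    using assms(2) by (simp add: digit_sequences_def)
  have "digit_series w \<epsilon> = (\<Sum>k. of_nat (\<epsilon> (Suc k)) * w ^ Suc k) + of_nat (\<epsilon> 0) * w ^ 0"
    unfolding digit_series_def suminf_split_head[OF summable_digit_series[OF assms]]
    by (rule diff_add_cancel[symmetric])
  also have "(\<Sum>k. of_nat (\<epsilon> (Suc k)) * w ^ Suc k) = (\<Sum>k. w * (of_nat (\<epsilon> (Suc k)) * w ^ k))"
    by (simp add: mult.left_commute)
  also have "\<dots> = w * digit_series w (\<lambda>k. \<epsilon> (Suc k))"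
    unfolding digit_series_def by (rule suminf_mult[OF summable_digit_series[OF assms(1) shift]])
  finally show ?thesis
    by simp
qed

lemma digit_sums_self_similar:
  assumes "norm w < 1"
  shows "digit_sums w = (\<lambda>z. w * z) ` digit_sums w \<union> (\<lambda>z. w * z + 1) ` digit_sums w"
proof (intro equalityI subsetI)
  fix x assume "x \<in> digit_sums w"
  then obtain \<epsilon> where \<epsilon>: "\<epsilon> \<in> digit_sequences" "x = digit_series w \<epsilon>"
    unfolding digit_sums_def by blast
  have "(\<lambda>k. \<epsilon> (Suc k)) \<in> digit_sequences"
    using \<epsilon>(1) by (simp add: digit_sequences_def)
  then obtain y where y: "y \<in> digit_sums w" "x = w * y + of_nat (\<epsilon> 0)"
    using digit_series_unfold[OF assms \<epsilon>(1)] \<epsilon>(2) unfolding digit_sums_def by blast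
  have "\<epsilon> 0 = 0 \<or> \<epsilon> 0 = 1"
    using \<epsilon>(1) by (simp add: digit_sequences_def)
  then have "x = w * y \<or> x = w * y + 1"
    unfolding y(2) by (elim disjE) simp_all
  with y(1) show "x \<in> (\<lambda>z. w * z) ` digit_sums w \<union> (\<lambda>z. w * z + 1) ` digit_sums w"
    by blast
next
  have prepend: "w * y + of_nat e \<in> digit_sums w"
    if "y \<in> digit_sums w" and e: "e \<in> {0, 1}" for y e
  proof -
    obtain \<epsilon> where \<epsilon>: "\<epsilon> \<in> digit_sequences" "y = digit_series w \<epsilon>"
      using \<open>y \<in> digit_sums w\<close> unfolding digit_sums_def by blast
    have mem: "case_nat e \<epsilon> \<in> digit_sequences"
      using \<epsilon>(1) e by (simp add: digit_sequences_def split: nat.split)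
    have "w * y + of_nat e = digit_series w (case_nat e \<epsilon>)"
      unfolding digit_series_unfold[OF assms mem] \<epsilon>(2) by simp
    with mem show ?thesis
      unfolding digit_sums_def by (metis imageI)
  qed
  fix x assume "x \<in> (\<lambda>z. w * z) ` digit_sums w \<union> (\<lambda>z. w * z + 1) ` digit_sums w"
  then obtain y where "y \<in> digit_sums w" "x = w * y \<or> x = w * y + 1"
    by blast
  then show "x \<in> digit_sums w"
    using prepend[of y 0] prepend[of y 1] by (elim disjE) simp_all
qed

text \<open>
  Tychonoff: the type \<open>nat \<Rightarrow> nat\<close> carries the product topology of discrete spaces.
\<close>

lemma compact_digit_sequences: "compact digit_sequences"
proof -
  have "digit_sequences = PiE UNIV (\<lambda>_. {0, 1})"
    unfolding digit_sequences_def by (simp add: PiE_UNIV_domain Pi_def)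
  moreover have "compactin (product_topology (\<lambda>_. euclidean) UNIV) (PiE UNIV (\<lambda>_::nat. {0, 1::nat}))"
    unfolding compactin_PiE compactin_euclidean_iff by (intro disjI2 ballI finite_imp_compact) simp
  ultimately show ?thesis
    unfolding euclidean_product_topology compactin_euclidean_iff by (rule ssubst)
qed

text \<open>
  The geometric majorant does not depend on the digits, so the partial sums, each depending on
  finitely many coordinates, converge uniformly.
\<close>

lemma continuous_on_digit_series:
  assumes "norm w < 1"
  shows "continuous_on digit_sequences (digit_series w)"
proof (rule uniform_limit_theorem)
  show "uniform_limit digit_sequences (\<lambda>n \<epsilon>. \<Sum>k<n. of_nat (\<epsilon> k) * w ^ k) (digit_series w) sequentially"
    unfolding digit_series_def
    using norm_digit_term_le summable_geometric[of "norm w"] assms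
    by (intro Weierstrass_m_test[of _ _ "\<lambda>k. norm w ^ k"]) auto
  have "continuous_on digit_sequences (\<lambda>\<epsilon>. \<epsilon> k)" for k :: nat
    by (rule continuous_on_product_coordinates[THEN continuous_on_subset]) simp
  then show "\<forall>\<^sub>F n in sequentially. continuous_on digit_sequences (\<lambda>\<epsilon>. \<Sum>k<n. of_nat (\<epsilon> k) * w ^ k)"
    by (intro always_eventually allI continuous_on_sum continuous_on_mult continuous_on_of_nat
        continuous_on_const)
qed simp

lemma compact_digit_sums:
  assumes "norm w < 1"
  shows "compact (digit_sums w)"
  unfolding digit_sums_def
  using continuous_on_digit_series[OF assms] compact_digit_sequences
  by (rule compact_continuous_image)

section \<open>The attractor as a set of digit series\<close>

text \<open>
  The expression under the limit is what \<open>n\<close> applications of the maps chosen by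
  \<open>\<epsilon>\<close> produce from the point \<open>x n\<close>. The points are merely bounded and may
  vary with \<open>n\<close>: one inclusion below uses the iterated preimages of a point, the other a single
  base point.
\<close>

lemma partial_sums_tendsto:
  assumes "norm w < 1" "\<epsilon> \<in> digit_sequences" "\<And>n. norm (x n) \<le> B"
  shows "(\<lambda>n. d * (\<Sum>k<n. of_nat (\<epsilon> k) * w ^ k) + w ^ n * x n) \<longlonglongrightarrow> d * digit_series w \<epsilon>"
proof -
  have "(\<lambda>n. w ^ n * x n) \<longlonglongrightarrow> 0"
  proof (rule Lim_null_comparison)
    show "\<forall>\<^sub>F n in sequentially. norm (w ^ n * x n) \<le> norm w ^ n * B"
      using assms(3) by (intro always_eventually allI)
        (auto simp: norm_mult norm_power intro: mult_left_mono)
    show "(\<lambda>n. norm w ^ n * B) \<longlonglongrightarrow> 0"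
      using assms(1) by (intro tendsto_mult_left_zero LIMSEQ_power_zero) auto
  qed
  moreover have "(\<lambda>n. d * (\<Sum>k<n. of_nat (\<epsilon> k) * w ^ k)) \<longlonglongrightarrow> d * digit_series w \<epsilon>"
    unfolding digit_series_def
    by (intro tendsto_mult tendsto_const summable_LIMSEQ summable_digit_series assms)
  ultimately show ?thesis
    using tendsto_add[of "\<lambda>n. d * (\<Sum>k<n. of_nat (\<epsilon> k) * w ^ k)" "d * digit_series w \<epsilon>"
        sequentially "\<lambda>n. w ^ n * x n" 0] by simp
qed

text \<open>
  The coding argument behind uniqueness. Following preimages of a point of \<open>K\<close> inside \<open>K\<close> reads
  off its digits, which gives one inclusion; for the other, a prescribed digit sequence is realised
  by pushing any base point of \<open>K\<close> forward and passing to the limit in the closed set \<open>K\<close>.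
\<close>

lemma invariant_compact_eq:
  assumes w: "norm w < 1" and "K \<noteq> {}" "compact K"
    and inv: "K = (\<lambda>z. w * z) ` K \<union> (\<lambda>z. w * z + d) ` K"
  shows "K = (\<lambda>z. d * z) ` digit_sums w"
proof (intro equalityI subsetI)
  fix x assume "x \<in> K"
  obtain B where B: "\<And>x. x \<in> K \<Longrightarrow> norm x \<le> B"
    using compact_imp_bounded[OF \<open>compact K\<close>] by (auto simp: bounded_iff)
  have "\<exists>p. fst p \<in> {0, 1} \<and> snd p \<in> K \<and> y = w * snd p + d * of_nat (fst p)"
    if "y \<in> K" for y
  proof -
    have "y \<in> (\<lambda>z. w * z) ` K \<union> (\<lambda>z. w * z + d) ` K"
      using that inv by (rule back_subst)
    then obtain z where "z \<in> K" "y = w * z + d * of_nat 0 \<or> y = w * z + d * of_nat 1"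
      by auto
    then show ?thesis
      by force
  qed
  \<comment> \<open>\<open>p y\<close> is the digit of \<open>y\<close> together with its preimage under the map with that digit.\<close>
  then obtain p where p: "\<And>y. y \<in> K \<Longrightarrow> fst (p y) \<in> {0, 1::nat} \<and> snd (p y) \<in> K
      \<and> y = w * snd (p y) + d * of_nat (fst (p y))"
    by metis
  define X where "X n = ((\<lambda>y. snd (p y)) ^^ n) x" for n
  define \<epsilon> where "\<epsilon> n = fst (p (X n))" for n
  have X: "X n \<in> K" for n
    by (induction n) (use \<open>x \<in> K\<close> p in \<open>auto simp: X_def\<close>)
  have step: "X n = w * X (Suc n) + d * of_nat (\<epsilon> n)" for n
    using p[OF X[of n]] by (simp add: X_def \<epsilon>_def)
  have \<epsilon>: "\<epsilon> \<in> digit_sequences"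
    using p X by (auto simp: \<epsilon>_def digit_sequences_def)
  have "x = d * (\<Sum>k<n. of_nat (\<epsilon> k) * w ^ k) + w ^ n * X n" for n
  proof (induction n)
    case 0
    show ?case by (simp add: X_def)
  next
    case (Suc n)
    then show ?case
      by (subst (asm) step) (simp add: algebra_simps)
  qed
  then have "(\<lambda>_. x) \<longlonglongrightarrow> d * digit_series w \<epsilon>"
    using partial_sums_tendsto[OF w \<epsilon>, of X B d] B X by simp
  then have "x = d * digit_series w \<epsilon>"
    by (simp add: LIMSEQ_const_iff)
  then show "x \<in> (\<lambda>z. d * z) ` digit_sums w"
    using \<epsilon> by (auto simp: digit_sums_def)
next
  fix x assume "x \<in> (\<lambda>z. d * z) ` digit_sums w"
  then obtain \<epsilon> where \<epsilon>: "\<epsilon> \<in> digit_sequences" "x = d * digit_series w \<epsilon>"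
    by (auto simp: digit_sums_def)
  obtain a where "a \<in> K"
    using \<open>K \<noteq> {}\<close> by auto
  have maps: "w * y \<in> K" "w * y + d \<in> K" if "y \<in> K" for y
    using that inv by blast+
  have "d * (\<Sum>k<n. of_nat (\<eta> k) * w ^ k) + w ^ n * a \<in> K"
    if "\<eta> \<in> digit_sequences" for n \<eta>
    using that
  proof (induction n arbitrary: \<eta>)
    case 0
    show ?case using \<open>a \<in> K\<close> by simp
  next
    case (Suc n)
    \<comment> \<open>The leading digit belongs to the map applied last, so the induction peels off \<open>\<eta> 0\<close>.\<close>
    let ?y = "d * (\<Sum>k<n. of_nat (\<eta> (Suc k)) * w ^ k) + w ^ n * a"
    have "?y \<in> K"
      using Suc.prems by (intro Suc.IH) (simp add: digit_sequences_def)
    moreover have "\<eta> 0 = 0 \<or> \<eta> 0 = 1"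
      using Suc.prems by (auto simp: digit_sequences_def)
    ultimately have "w * ?y + d * of_nat (\<eta> 0) \<in> K"
      using maps by auto
    also have "w * ?y + d * of_nat (\<eta> 0)
        = d * (\<Sum>k<Suc n. of_nat (\<eta> k) * w ^ k) + w ^ Suc n * a"
      by (simp add: sum.lessThan_Suc_shift sum_distrib_left algebra_simps
          del: sum.lessThan_Suc)
    finally show ?case .
  qed
  then show "x \<in> K"
    using closed_sequentially[OF compact_imp_closed[OF \<open>compact K\<close>]
        _ partial_sums_tendsto[OF w \<epsilon>(1), of "\<lambda>_. a" "norm a" d]] \<epsilon>
    by simp
qed

lemma attractor_eq_digit_sums:
  assumes "norm w < 1"
  shows "attractor (\<lambda>z. w * z) (\<lambda>z. w * z + d) = (\<lambda>z. d * z) ` digit_sums w"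
  unfolding attractor_def
proof (rule the_equality, intro conjI)
  let ?D = "digit_sums w"
  have "(\<lambda>_. 0) \<in> digit_sequences"
    by (simp add: digit_sequences_def)
  then show "(\<lambda>z. d * z) ` ?D \<noteq> {}"
    by (auto simp: digit_sums_def)
  show "compact ((\<lambda>z. d * z) ` ?D)"
    using compact_digit_sums[OF assms]
    by (intro compact_continuous_image continuous_intros)
  show "(\<lambda>z. d * z) ` ?D
      = (\<lambda>z. w * z) ` (\<lambda>z. d * z) ` ?D \<union> (\<lambda>z. w * z + d) ` (\<lambda>z. d * z) ` ?D"
    by (subst digit_sums_self_similar[OF assms])
       (simp add: image_Un image_image algebra_simps)
next
  fix K assume "K \<noteq> {} \<and> compact K \<and> K = (\<lambda>z. w * z) ` K \<union> (\<lambda>z. w * z + d) ` K"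
  then show "K = (\<lambda>z. d * z) ` digit_sums w"
    using invariant_compact_eq[OF assms, of K d] by (elim conjE)
qed

section \<open>The Twindragon\<close>

lemma powi_uminus_eq_power_divide:
  "(1 + \<i>) powi (- int k) = (1 / (1 + \<i>)) ^ k"
  by (simp only: power_int_minus power_int_of_nat inverse_eq_divide power_one_over)

lemma norm_inverse_base: "norm (1 / (1 + \<i>)) < 1"
  by (simp add: norm_divide) (simp add: cmod_def)

lemma twindragon_eq_digit_sums:
  assumes "w = 1 / (1 + \<i>)"
  shows "twindragon = (\<lambda>z. w * z) ` digit_sums w"
proof -
  have w: "norm w < 1"
    by (simp only: assms norm_inverse_base)
  have series: "(\<Sum>j. of_nat (\<delta> (Suc j)) * (1 + \<i>) powi (- int (Suc j)))
      = w * digit_series w (\<lambda>k. \<delta> (Suc k))" if "\<forall>k. \<delta> k \<in> {0, 1}" for \<delta> :: "nat \<Rightarrow> nat"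
  proof -
    have "(\<lambda>k. \<delta> (Suc k)) \<in> digit_sequences"
      using that by (simp add: digit_sequences_def)
    from suminf_mult[OF summable_digit_series[OF w this], of w] show ?thesis
      unfolding powi_uminus_eq_power_divide digit_series_def assms[symmetric]
      by (simp add: mult.left_commute)
  qed
  show ?thesis
  proof (intro equalityI subsetI)
    fix x assume "x \<in> twindragon"
    then obtain \<delta> :: "nat \<Rightarrow> nat" where \<delta>: "\<forall>k. \<delta> k \<in> {0, 1}"
        "x = (\<Sum>j. of_nat (\<delta> (Suc j)) * (1 + \<i>) powi (- int (Suc j)))"
      unfolding twindragon_def by blast
    have "(\<lambda>k. \<delta> (Suc k)) \<in> digit_sequences"
      using \<delta>(1) by (simp add: digit_sequences_def)
    then show "x \<in> (\<lambda>z. w * z) ` digit_sums w"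
      using series[OF \<delta>(1)] \<delta>(2) unfolding digit_sums_def by blast
  next
    fix x assume "x \<in> (\<lambda>z. w * z) ` digit_sums w"
    then obtain \<epsilon> where \<epsilon>: "\<epsilon> \<in> digit_sequences" "x = w * digit_series w \<epsilon>"
      by (auto simp: digit_sums_def)
    \<comment> \<open>The Twindragon series starts at index 1, so the digits move up by one place; 0 is arbitrary.\<close>
    have \<delta>: "\<forall>k. case_nat 0 \<epsilon> k \<in> {0, 1}"
      using \<epsilon>(1) by (auto simp: digit_sequences_def split: nat.split)
    have "x = (\<Sum>j. of_nat (case_nat 0 \<epsilon> (Suc j)) * (1 + \<i>) powi (- int (Suc j)))"
      unfolding series[OF \<delta>] using \<epsilon>(2) by simp
    with \<delta> show "x \<in> twindragon"
      unfolding twindragon_def by blast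
  qed
qed

lemma one_plus_i_nonzero: "1 + \<i> \<noteq> 0"
  by (simp add: complex_eq_iff)

lemma inv_map_S: "inv map_S = (\<lambda>z. z / (1 + \<i>))"
  by (rule inv_equality) (simp_all add: map_S_def one_plus_i_nonzero)

lemma inv_map_T: "inv map_T = (\<lambda>z. (z - (2 + \<i>)) / (1 + \<i>))"
  by (rule inv_equality) (simp_all add: map_T_def one_plus_i_nonzero)

lemma similarity_mult:
  assumes "c \<noteq> 0"
  shows "similarity (\<lambda>z. c * z)"
  unfolding similarity_def
proof (intro conjI exI allI)
  show "bij (\<lambda>z. c * z)"
    by (rule bij_betw_byWitness[where f' = "\<lambda>z. z / c"]) (use assms in auto)
  show "0 < norm c"
    using assms by simp
  show "dist (c * x) (c * y) = norm c * dist x y" for x y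
    by (simp add: dist_norm norm_mult flip: right_diff_distrib)
qed

theorem mainTheorem3:
  fixes A :: "complex set"
  assumes "A = attractor (inv map_S) (inv map_T)"
  shows "(\<forall>z. inv map_S z = z / (1 + \<i>)) \<and>
         (\<forall>z. inv map_T z = (z - (2 + \<i>)) / (1 + \<i>)) \<and>
         A = {- ((2 + \<i>) / (1 + \<i>)) * (\<Sum>k. of_nat (\<epsilon> k) * (1 + \<i>) powi (- int k)) | \<epsilon> :: nat \<Rightarrow> nat.
                \<forall>k. \<epsilon> k \<in> {0, 1}} \<and>
         A = (\<lambda>z. (- 2 - \<i>) * z) ` twindragon \<and>
         similarity (\<lambda>z. (- 2 - \<i>) * z) \<and>
         similar_sets twindragon A"
proof -
  define w where "w = 1 / (1 + \<i>)"
  define d where "d = - ((2 + \<i>) / (1 + \<i>))"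
  have w: "norm w < 1"
    by (simp only: w_def norm_inverse_base)
  have d: "d = (- 2 - \<i>) * w"
    unfolding w_def d_def minus_divide_left by simp
  have S: "inv map_S = (\<lambda>z. w * z)"
    by (simp add: inv_map_S w_def)
  have T: "inv map_T = (\<lambda>z. w * z + d)"
    by (simp only: inv_map_T w_def d_def diff_divide_distrib) simp
  have A: "A = (\<lambda>z. d * z) ` digit_sums w"
    unfolding assms S T by (rule attractor_eq_digit_sums[OF w])
  have series: "A = {d * (\<Sum>k. of_nat (\<epsilon> k) * (1 + \<i>) powi (- int k)) | \<epsilon> :: nat \<Rightarrow> nat.
      \<forall>k. \<epsilon> k \<in> {0, 1}}"
    unfolding A powi_uminus_eq_power_divide w_def[symmetric]
      digit_sums_def digit_series_def digit_sequences_def by blast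
  have twindragon: "A = (\<lambda>z. (- 2 - \<i>) * z) ` twindragon"
    unfolding A d twindragon_eq_digit_sums[OF w_def] image_image mult.assoc ..
  have similarity: "similarity (\<lambda>z. (- 2 - \<i>) * z)"
    by (rule similarity_mult) (simp add: complex_eq_iff)
  have similar: "similar_sets twindragon A"
    unfolding similar_sets_def using twindragon similarity by blast
  show ?thesis
    using series twindragon similarity similar unfolding d_def
    by (intro conjI allI) (simp_all only: inv_map_S inv_map_T)
qed

end
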